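(* Let $u,v,w,n$ be non-negative integers. Let $A(u,v,w,n)$ denote the number of partitions of $n$ into distinct parts, each congruent to $4$, $6$ or $9$ modulo $10$, with exactly $u$ parts congruent to $4$, $v$ parts congruent to $6$ and $w$ parts congruent to $9$ modulo $10$. Let $B(u,v,w,n)$ denote the number of partitions $\lambda_1+\cdots+\lambda_s$ of $n$ (parts in decreasing order) such that: (1) no part is equal to $2,3,5,8$ or congruent to $1,7,11,12,17 \bmod 20$; (2) $u$ equals the number of parts congruent to $0,3,4 \bmod 10$ plus twice the number of parts congruent to $18\bmod 20$; (3) $v$ equals the number of parts congruent to $0,5,6\bmod 10$ plus twice the number of parts congruent to $2\bmod 20$; (4) $w$ equals the number of parts congruent to $3,5,9\bmod 10$ plus twice the number of parts congruent to $8\bmod 20$; (5) any two consecutive parts differ by at least $9$, and whenever $9\le\lambda_i-\lambda_{i+1}\le 20$, the residue of $\lambda_i$ modulo $20$ belongs to the set given by the following list according to the value of $\lambda_i-\lambda_{i+1}$: - difference $9$: $\{4,19\}$; - difference $10$: $\emptyset$ (so this difference does not occur); - difference $11$: $\{4,6,10,15\}$; - difference $12$: $\{6,15,16\}$; - difference $13$: $\{3,6,9,16,19\}$; - difference $14$: $\{4,9,10,13,19\}$; - difference $15$: $\{4,5,9,10,14,15,19\}$; - difference $16$: $\{0,4,6,9,10,15,16,19\}$; - difference $17$: $\{0,3,6,10,13,15,16,19\}$; - difference $18$: $\{2,3,4,6,8,13,14,16\}$; - difference $19$: $\{2,3,4,5,9,13,14,15,18,19\}$; - difference $20$: $\{0,3,4,5,6,9,10,13,14,15,16,19\}$.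 Then $A(u,v,w,n)=B(u,v,w,n)$.
   Context: A partition of $n$ is a finite non-increasing sequence of positive integers (parts) with sum $n$. *)

theory Defs
  imports Main
begin

definition is_partition :: "nat \<Rightarrow> nat list \<Rightarrow> bool" where
  "is_partition n ps \<longleftrightarrow> sorted_wrt (\<ge>) ps \<and> (\<forall>p \<in> set ps. 0 < p) \<and> sum_list ps = n"

text \<open>Hence the cardinalities of sets of partitions of \<open>n\<close> below are genuine counts.\<close>

lemma finite_partitions: "finite {ps. is_partition n ps}"
proof (rule finite_subset)
  have len: "length ps \<le> sum_list ps" if "\<forall>p \<in> set ps. 0 < p" for ps :: "nat list"
    using that by (induction ps) auto
  show "{ps. is_partition n ps} \<subseteq> {ps. set ps \<subseteq> {..n} \<and> length ps \<le> n}"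
    using len member_le_sum_list by (fastforce simp: is_partition_def)
  show "finite {ps. set ps \<subseteq> {..n} \<and> length ps \<le> n}"
    by (rule finite_lists_length_le) simp
qed

definition num_parts :: "nat \<Rightarrow> nat set \<Rightarrow> nat list \<Rightarrow> nat" where
  "num_parts m R ps = length (filter (\<lambda>p. p mod m \<in> R) ps)"

definition A :: "nat \<Rightarrow> nat \<Rightarrow> nat \<Rightarrow> nat \<Rightarrow> nat" where
  "A u v w n = card {ps. is_partition n ps \<and> distinct ps \<and>
     (\<forall>p \<in> set ps. p mod 10 \<in> {4, 6, 9}) \<and>
     num_parts 10 {4} ps = u \<and> num_parts 10 {6} ps = v \<and> num_parts 10 {9} ps = w}"

text \<open>
  \<open>allowed_residues d\<close> contains the residues modulo 20 allowed for the larger of two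
  consecutive parts whose difference is \<open>d\<close>. It is only used for \<open>9 \<le> d \<le> 20\<close>,
  so the last branch serves \<open>d = 10\<close>: this difference does not occur.
\<close>

definition allowed_residues :: "nat \<Rightarrow> nat set" where
  "allowed_residues d =
    (if d = 9 then {4, 19}
     else if d = 11 then {4, 6, 10, 15}
     else if d = 12 then {6, 15, 16}
     else if d = 13 then {3, 6, 9, 16, 19}
     else if d = 14 then {4, 9, 10, 13, 19}
     else if d = 15 then {4, 5, 9, 10, 14, 15, 19}
     else if d = 16 then {0, 4, 6, 9, 10, 15, 16, 19}
     else if d = 17 then {0, 3, 6, 10, 13, 15, 16, 19}
     else if d = 18 then {2, 3, 4, 6, 8, 13, 14, 16}
     else if d = 19 then {2, 3, 4, 5, 9, 13, 14, 15, 18, 19}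
     else if d = 20 then {0, 3, 4, 5, 6, 9, 10, 13, 14, 15, 16, 19}
     else {})"

text \<open>Parts are listed in non-increasing order, so the subtraction below never truncates.\<close>

definition difference_conditions :: "nat list \<Rightarrow> bool" where
  "difference_conditions ps \<longleftrightarrow>
     (\<forall>i. Suc i < length ps \<longrightarrow>
        (let d = ps ! i - ps ! Suc i in
           9 \<le> d \<and> (d \<le> 20 \<longrightarrow> ps ! i mod 20 \<in> allowed_residues d)))"

definition B :: "nat \<Rightarrow> nat \<Rightarrow> nat \<Rightarrow> nat \<Rightarrow> nat" where
  "B u v w n = card {ps. is_partition n ps \<and>
     (\<forall>p \<in> set ps. p \<notin> {2, 3, 5, 8} \<and> p mod 20 \<notin> {1, 7, 11, 12, 17}) \<and>
     u = num_parts 10 {0, 3, 4} ps + 2 * num_parts 20 {18} ps \<and>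
     v = num_parts 10 {0, 5, 6} ps + 2 * num_parts 20 {2} ps \<and>
     w = num_parts 10 {3, 5, 9} ps + 2 * num_parts 20 {8} ps \<and>
     difference_conditions ps}"

end

theory Submission
  imports Defs "HOL-Library.Product_Plus"
begin

text \<open>
  Number the integers congruent to 4, 6 or 9 modulo 10 in increasing order as
  \<open>P 0 = 4, P 1 = 6, P 2 = 9, P 3 = 14, \<dots>\<close>, and give \<open>P i\<close> a formal weight \<open>x i\<close> recording its
  residue class and its size; then \<open>x (i + 3)\<close> is \<open>x i\<close> with the size increased by 10. The
  partitions counted by \<open>A\<close> are the finite sets of indices, with generating function the product
  of the factors \<open>1 + x i\<close>.

  Every part allowed in the partitions counted by \<open>B\<close> is, in exactly one way, either a
  primary part \<open>P i\<close> or a secondary part \<open>P l + P h\<close> with \<open>l < h \<le> l + 3\<close>, and it contributes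
  to \<open>u\<close>, \<open>v\<close>, \<open>w\<close> and \<open>n\<close> as the weight \<open>x i\<close> or \<open>x l * x h\<close> prescribes. In these terms the
  difference conditions are simple: consecutive primary parts have indices at least 4 apart, the index
  pairs of consecutive secondary parts are disjoint and ordered, and a primary and a secondary
  part are compared after sending each index \<open>j\<close> of the secondary part to the position
  \<open>j + 3 * (j div 3)\<close> among the primary indices (lemma \<open>gap_decode\<close>).

  The idea is to let this comparison depend on a parameter \<open>t\<close>, replacing the position by
  \<open>j + 3 * ((j - t) div 3)\<close>. Let \<open>F t\<close> be the generating function of the resulting sequences
  with all indices at least \<open>t\<close>. Then \<open>F t = (1 + x t) * F (t + 1)\<close>, so \<open>F 0\<close> is the product above.
  The recursion has two steps.

  Passing from \<open>t + 1\<close> to \<open>t\<close> while keeping all indices at least \<open>t\<close> only affects secondary parts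
  with an index congruent to \<open>t\<close> modulo 3. Some pairs of a secondary part directly below a primary
  part become forbidden, and an equal number of pairs of a primary part directly below a
  secondary part become allowed. Exchanging these pairs, from the bottom of the
  sequence to the top, is a weight-preserving bijection (lemma \<open>bij_raise\<close>).

  In a sequence for the parameter \<open>t + 1\<close> with indices at least \<open>t\<close>, the index \<open>t\<close> can
  only occur in the smallest part. Deleting it, so that \<open>P t + P h\<close> becomes \<open>P h\<close>, leaves an
  arbitrary sequence with indices at least \<open>t + 1\<close> (lemma \<open>bij_attach\<close>).
\<close>

section \<open>Primary and secondary parts\<close>

text \<open>
  \<open>Prim i\<close> is the primary part with index \<open>i\<close>, and \<open>Sec l h\<close> is the sum of the primary parts with
  indices \<open>l < h\<close>. Indices are integers so that index arithmetic does not truncate.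
\<close>

datatype part = Prim int | Sec int int

text \<open>
  The position among the primary indices at which an index \<open>j\<close> of a secondary part is compared
  with a primary part. On each block \<open>{t + 3 * k..<t + 3 * k + 3}\<close> it is the shift by \<open>3 * k\<close>.
\<close>

definition slot :: "int \<Rightarrow> int \<Rightarrow> int" where
  "slot t j = j + 3 * ((j - t) div 3)"

text \<open>
  The difference condition with parameter \<open>t\<close>: \<open>gap t x y\<close> says that \<open>x\<close> may be the next smaller part
  after \<open>y\<close>. Below, partitions into such parts are listed with the smallest part first.
\<close>

fun gap :: "int \<Rightarrow> part \<Rightarrow> part \<Rightarrow> bool" where
  "gap t (Prim i) (Prim j) \<longleftrightarrow> i + 4 \<le> j"
| "gap t (Sec l h) (Prim i) \<longleftrightarrow> slot t h + 4 \<le> i"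
| "gap t (Prim i) (Sec l h) \<longleftrightarrow> i < slot t l"
| "gap t (Sec l h) (Sec l' h') \<longleftrightarrow> h < l'"

text \<open>
  The parts all of whose indices are at least \<open>t\<close>; the two indices of a secondary part differ by 1, 2 or 3.
\<close>

fun valid :: "int \<Rightarrow> part \<Rightarrow> bool" where
  "valid t (Prim i) \<longleftrightarrow> t \<le> i"
| "valid t (Sec l h) \<longleftrightarrow> t \<le> l \<and> l < h \<and> h \<le> l + 3"

section \<open>Exchanging a secondary and a primary part\<close>

text \<open>
  If the pair of a secondary part \<open>x\<close> directly below a primary part \<open>y\<close> satisfies the gap condition
  for \<open>t + 1\<close> but not for \<open>t\<close>, then \<open>up t x y\<close> is the pair, with the primary part below,
  that replaces it. The three indices involved are redistributed and shifted by multiples of 3 with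
  total shift 0, which preserves the weight.
\<close>

fun up :: "int \<Rightarrow> part \<Rightarrow> part \<Rightarrow> (part \<times> part) option" where
  "up t (Sec l h) (Prim i) =
     (if 3 dvd h - t \<and> 2 * h - t < i \<and> i \<le> 2 * h - t + 3
      then Some (Prim (l + (h - t)), Sec h (i - (h - t))) else None)"
| "up t _ _ = None"

text \<open>The inverse exchange, for pairs satisfying the gap condition for \<open>t\<close> but not for \<open>t + 1\<close>.\<close>

fun down :: "int \<Rightarrow> part \<Rightarrow> part \<Rightarrow> (part \<times> part) option" where
  "down t (Prim i) (Sec l h) =
     (if 3 dvd l - t \<and> 2 * l - t - 3 \<le> i \<and> i < 2 * l - t
      then Some (Sec (i - (l - t)) l, Prim (h + (l - t))) else None)"
| "down t _ _ = None"

lemma up_eq_SomeE: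
  assumes "up t x y = Some (x', y')"
  obtains l k i where "x = Sec l (t + 3 * k)" "y = Prim (t + 6 * k + i)" "1 \<le> i" "i \<le> 3"
    "x' = Prim (l + 3 * k)" "y' = Sec (t + 3 * k) (t + 3 * k + i)"
proof -
  obtain l h i where xy: "x = Sec l h" "y = Prim i" "3 dvd h - t" "2 * h - t < i" "i \<le> 2 * h - t + 3"
    "x' = Prim (l + (h - t))" "y' = Sec h (i - (h - t))"
    using assms by (cases "(t, x, y)" rule: up.cases) (auto split: if_splits)
  moreover obtain k where "h - t = 3 * k" using xy(3) by blast
  ultimately show thesis
    by (intro that[of l k "i - t - 6 * k"]) (auto simp: algebra_simps)
qed

lemma down_eq_SomeE:
  assumes "down t x y = Some (x', y')"
  obtains h k i where "x = Prim (t + 6 * k - i)" "y = Sec (t + 3 * k) h" "1 \<le> i" "i \<le> 3"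
    "x' = Sec (t + 3 * k - i) (t + 3 * k)" "y' = Prim (h + 3 * k)"
proof -
  obtain l h i where xy: "x = Prim i" "y = Sec l h" "3 dvd l - t" "2 * l - t - 3 \<le> i" "i < 2 * l - t"
    "x' = Sec (i - (l - t)) l" "y' = Prim (h + (l - t))"
    using assms by (cases "(t, x, y)" rule: down.cases) (auto split: if_splits)
  moreover obtain k where "l - t = 3 * k" using xy(3) by blast
  ultimately show thesis
    by (intro that[of k "t + 6 * k - i" h]) (auto simp: algebra_simps)
qed

lemma down_up:
  assumes "up t x y = Some (x', y')" "valid t x"
  shows "down t x' y' = Some (x, y)"
  using assms by (elim up_eq_SomeE) (auto simp: algebra_simps)

lemma up_down:
  assumes "down t x y = Some (x', y')" "valid t y"
  shows "up t x' y' = Some (x, y)"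
  using assms by (elim down_eq_SomeE) (auto simp: algebra_simps)

lemma slot_block:
  assumes "t + 3 * k \<le> j" "j < t + 3 * k + 3"
  shows "slot t j = j + 3 * k"
proof -
  have "(j - t) div 3 = k" using assms by presburger
  then show ?thesis by (simp add: slot_def)
qed

lemma slot_strict_mono: "slot t i < slot t j \<longleftrightarrow> i < j"
proof -
  have "slot t i < slot t j" if "i < j" for i j
    using that zdiv_mono1[of "i - t" "j - t" 3] by (simp add: slot_def)
  then show ?thesis by (metis linorder_neqE not_less_iff_gr_or_eq)
qed

lemma slot_dvd: "3 dvd j - t \<Longrightarrow> slot t j = 2 * j - t"
  by (auto simp: slot_def)

lemma slot_Suc: "slot (t + 1) j = (if 3 dvd j - t then slot t j - 3 else slot t j)"
proof -
  have "(j - (t + 1)) div 3 = (j - t) div 3 - (if 3 dvd j - t then 1 else 0)"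
    by presburger
  then show ?thesis by (simp add: slot_def)
qed

lemma gap_imp_up_None: "gap t x y \<Longrightarrow> up t x y = None"
  by (cases "(t, x, y)" rule: up.cases) (auto simp: slot_dvd)

lemma gap_imp_down_None: "gap (t + 1) x y \<Longrightarrow> down t x y = None"
  by (cases "(t, x, y)" rule: down.cases) (auto simp: slot_dvd slot_Suc)

lemma gap_of_up_None: "gap (t + 1) x y \<Longrightarrow> up t x y = None \<Longrightarrow> gap t x y"
  by (cases "(t, x, y)" rule: gap.cases) (auto simp: slot_dvd slot_Suc split: if_splits)

lemma gap_of_down_None: "gap t x y \<Longrightarrow> down t x y = None \<Longrightarrow> gap (t + 1) x y"
  by (cases "(t, x, y)" rule: gap.cases) (auto simp: slot_dvd slot_Suc split: if_splits)

text \<open>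
  An exchange does not interfere with the neighbours of the pair: the new upper part has the same
  upper neighbours for \<open>t + 1\<close> as the old one, and the new lower part has the same lower neighbours
  for \<open>t\<close>.
\<close>

lemma up_gap_above:
  assumes "up t x y = Some (x', y')"
  shows "gap (t + 1) y' z \<longleftrightarrow> gap (t + 1) y z"
proof -
  obtain k i where *: "y = Prim (t + 6 * k + i)" "1 \<le> i" "i \<le> 3" "y' = Sec (t + 3 * k) (t + 3 * k + i)"
    using assms by (elim up_eq_SomeE)
  then have h: "slot (t + 1) (t + 3 * k + i) = t + 6 * k + i"
    using slot_block[of "t + 1" k "t + 3 * k + i"] by simp
  then have "t + 3 * k + i < l \<longleftrightarrow> t + 6 * k + i < slot (t + 1) l" for l
    using slot_strict_mono[of "t + 1" "t + 3 * k + i" l] by simp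
  then show ?thesis
    using * h by (cases z) auto
qed

lemma up_gap_below:
  assumes "up t x y = Some (x', y')" "valid t x"
  shows "gap t z x' \<longleftrightarrow> gap t z x"
proof -
  obtain l k where *: "x = Sec l (t + 3 * k)" "x' = Prim (l + 3 * k)"
    using assms by (elim up_eq_SomeE)
  then have l: "slot t l = l + 3 * k - 3"
    using slot_block[of t "k - 1" l] assms(2) by simp
  have m: "slot t h + 4 \<le> l + 3 * k \<longleftrightarrow> h < l" for h
    using slot_strict_mono[of t h l] l by linarith
  show ?thesis
  proof (cases z)
    case (Prim i)
    then show ?thesis using * l by auto
  next
    case (Sec i h)
    then show ?thesis by (simp add: * m)
  qed
qed

lemma up_gap_stay:
  assumes "up t x y = Some (x', y')" "valid t x" "gap (t + 1) z x"
  shows "gap t z x'"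
proof -
  obtain l h where "x = Sec l h"
    using assms(1) by (elim up_eq_SomeE)
  then have "gap t z x"
    using assms(3) by (cases z) (auto simp: slot_Suc split: if_splits)
  then show ?thesis
    using up_gap_below[OF assms(1,2)] by simp
qed

text \<open>
  If the secondary part produced by an exchange is exchanged again with the next part, then the two
  primary parts left behind still have the required distance.
\<close>

lemma up_gap_twice:
  assumes "up t x y = Some (x', y')" "valid t x" "up t y' z = Some (y'', z')"
  shows "gap t x' y''"
proof -
  obtain l k i where 1: "x = Sec l (t + 3 * k)" "1 \<le> i" "x' = Prim (l + 3 * k)"
    "y' = Sec (t + 3 * k) (t + 3 * k + i)"
    using assms(1) by (elim up_eq_SomeE)
  obtain l' m where 2: "y' = Sec l' (t + 3 * m)" "y'' = Prim (l' + 3 * m)"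
    using assms(3) by (elim up_eq_SomeE)
  have "3 * k + i = 3 * m" using 1(4) 2(1) by simp
  then have "3 \<le> i" using 1(2) by presburger
  then show ?thesis
    using 1 2 assms(2) by simp
qed

lemma up_valid:
  assumes "up t x y = Some (x', y')" "valid t x" "valid t y"
  shows "valid t x'" "valid t y'"
  using assms by (elim up_eq_SomeE; simp)+

lemma down_valid:
  assumes "down t x y = Some (x', y')" "valid t x" "valid t y"
  shows "valid t x'" "valid t y'"
proof -
  obtain h k i where *: "x = Prim (t + 6 * k - i)" "y = Sec (t + 3 * k) h" "1 \<le> i" "i \<le> 3"
    "x' = Sec (t + 3 * k - i) (t + 3 * k)" "y' = Prim (h + 3 * k)"
    using assms(1) by (elim down_eq_SomeE)
  then have "t \<le> t + 6 * k - i" "t + 3 * k < h"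
    using assms(2,3) by auto
  moreover from this *(3) have "1 \<le> k" by presburger
  ultimately show "valid t x'" "valid t y'"
    using *(3-6) by auto
qed

lemma up_gap:
  assumes "up t x y = Some (x', y')" "valid t x"
  shows "gap t x' y'" "gap (t + 1) x y"
proof -
  obtain l k i where *: "x = Sec l (t + 3 * k)" "y = Prim (t + 6 * k + i)" "1 \<le> i"
    "x' = Prim (l + 3 * k)" "y' = Sec (t + 3 * k) (t + 3 * k + i)"
    using assms(1) by (elim up_eq_SomeE)
  have "slot t (t + 3 * k) = t + 6 * k" "slot (t + 1) (t + 3 * k) = t + 6 * k - 3"
    using slot_block[of t k "t + 3 * k"] slot_block[of "t + 1" "k - 1" "t + 3 * k"] by simp_all
  then show "gap t x' y'" "gap (t + 1) x y"
    using * assms(2) by auto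
qed

section \<open>The bijection between two consecutive parameters\<close>

text \<open>
  \<open>raise t\<close> carries out all exchanges from the smallest part upwards; a secondary part that was just
  moved up may move further. \<open>lower t\<close> undoes this from the largest part downwards.
\<close>

fun raise :: "int \<Rightarrow> part list \<Rightarrow> part list" where
  "raise t [] = []"
| "raise t [x] = [x]"
| "raise t (x # y # zs) = (case up t x y of
      None \<Rightarrow> x # raise t (y # zs)
    | Some (x', y') \<Rightarrow> x' # raise t (y' # zs))"

fun lower :: "int \<Rightarrow> part list \<Rightarrow> part list" where
  "lower t [] = []"
| "lower t (x # xs) = (case lower t xs of
      [] \<Rightarrow> [x]
    | y # ys \<Rightarrow> (case down t x y of
          None \<Rightarrow> x # y # ys
        | Some (x', y') \<Rightarrow> x' # y' # ys))"

text \<open>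
  The weight of the primary part with index \<open>i\<close>: the indicators of the residues 4, 6 and 9
  modulo 10, followed by the size.
\<close>

definition weight :: "int \<Rightarrow> int \<times> int \<times> int \<times> int" where
  "weight i =
    (if i mod 3 = 0 then (1, 0, 0, 10 * (i div 3) + 4)
     else if i mod 3 = 1 then (0, 1, 0, 10 * (i div 3) + 6)
     else (0, 0, 1, 10 * (i div 3) + 9))"

fun part_weight :: "part \<Rightarrow> int \<times> int \<times> int \<times> int" where
  "part_weight (Prim i) = weight i"
| "part_weight (Sec l h) = weight l + weight h"

lemma weight_add: "weight (i + 3 * k) = weight i + (0, 0, 0, 10 * k)"
  by (simp add: weight_def mod_add_left_eq)

lemma up_weight:
  assumes "up t x y = Some (x', y')"
  shows "part_weight x' + part_weight y' = part_weight x + part_weight y"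
proof -
  obtain l k i where *: "x = Sec l (t + 3 * k)" "y = Prim (t + 6 * k + i)"
    "x' = Prim (l + 3 * k)" "y' = Sec (t + 3 * k) (t + 3 * k + i)"
    using assms by (elim up_eq_SomeE)
  have "weight (t + 6 * k + i) = weight (t + i) + (0, 0, 0, 20 * k)"
    "weight (t + 3 * k + i) = weight (t + i) + (0, 0, 0, 10 * k)"
    using weight_add[of "t + i" "2 * k"] weight_add[of "t + i" k] by (simp_all add: algebra_simps)
  then show ?thesis
    by (simp add: * weight_add add.commute add.left_commute)
qed

text \<open>
  The lists of weight \<open>w\<close> satisfying the gap condition for \<open>s\<close>, with all indices at least \<open>t\<close>.
\<close>

definition gap_chains :: "int \<Rightarrow> int \<Rightarrow> int \<times> int \<times> int \<times> int \<Rightarrow> part list set" where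
  "gap_chains s t w = {xs. successively (gap s) xs \<and> (\<forall>x \<in> set xs. valid t x) \<and>
     sum_list (map part_weight xs) = w}"

lemma raise_weight: "sum_list (map part_weight (raise t xs)) = sum_list (map part_weight xs)"
proof (induction t xs rule: raise.induct)
  case (3 t x y zs)
  show ?case
  proof (cases "up t x y")
    case (Some a)
    obtain x' y' where a: "a = (x', y')" by fastforce
    have "sum_list (map part_weight (raise t (x # y # zs)))
        = part_weight x' + part_weight y' + sum_list (map part_weight zs)"
      using 3(2)[OF Some a[symmetric]] Some a by (simp add: algebra_simps)
    then show ?thesis
      using up_weight Some a by (simp add: algebra_simps)
  qed (use 3 in simp)
qed auto

lemma raise_valid: "\<forall>x \<in> set xs. valid t x \<Longrightarrow> \<forall>x \<in> set (raise t xs). valid t x"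
proof (induction t xs rule: raise.induct)
  case (3 t x y zs)
  then show ?case
    using up_valid[of t x y] by (fastforce split: option.splits)
qed auto

text \<open>
  The statement about the head is what the induction needs to compare the result with the part
  below it: the head is either unchanged or the primary part resulting from an exchange.
\<close>

lemma raise_chain:
  assumes "successively (gap (t + 1)) xs" "\<forall>x \<in> set xs. valid t x"
  shows "successively (gap t) (raise t xs) \<and> lower t (raise t xs) = xs \<and>
    (xs \<noteq> [] \<longrightarrow> raise t xs \<noteq> [] \<and>
      (hd (raise t xs) = hd xs \<or> (\<exists>y y'. up t (hd xs) y = Some (hd (raise t xs), y'))))"
  using assms
proof (induction t xs rule: raise.induct)
  case (3 t x y zs)
  have g: "gap (t + 1) x y" "valid t x" "valid t y"
    using 3(3,4) by auto
  show ?case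
  proof (cases "up t x y")
    case None
    define ys where "ys = raise t (y # zs)"
    have IH: "successively (gap t) ys" "lower t ys = y # zs" "ys \<noteq> []"
      "hd ys = y \<or> (\<exists>z z'. up t y z = Some (hd ys, z'))"
      using 3(1)[OF None] 3(3,4) unfolding ys_def by simp_all
    have "gap t x (hd ys)"
      using IH(4) gap_of_up_None[OF g(1) None] up_gap_stay[OF _ g(3,1)] by auto
    moreover have "down t x y = None"
      using g gap_imp_down_None by blast
    ultimately show ?thesis
      using None IH by (simp add: successively_Cons flip: ys_def)
  next
    case (Some a)
    obtain x' y' where a: "(x', y') = a" by (cases a) auto
    have u: "up t x y = Some (x', y')" using Some a by simp
    define ys where "ys = raise t (y' # zs)"
    have v: "valid t x'" "valid t y'"
      using up_valid[OF u g(2,3)] by auto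
    have c: "successively (gap (t + 1)) (y' # zs)"
      using 3(3) up_gap_above[OF u] by (auto simp: successively_Cons)
    have IH: "successively (gap t) ys" "lower t ys = y' # zs" "ys \<noteq> []"
      "hd ys = y' \<or> (\<exists>z z'. up t y' z = Some (hd ys, z'))"
      using 3(2)[OF Some a c] v 3(4) unfolding ys_def by simp_all
    have "gap t x' (hd ys)"
      using IH(4) up_gap(1)[OF u g(2)] up_gap_twice[OF u g(2)] by auto
    moreover have "raise t (x # y # zs) = x' # ys"
      using u by (simp add: ys_def)
    ultimately show ?thesis
      using IH u down_up[OF u g(2)] by (auto simp: successively_Cons)
  qed
qed auto

lemma lower_chain:
  assumes "successively (gap t) xs" "\<forall>x \<in> set xs. valid t x"
  shows "successively (gap (t + 1)) (lower t xs) \<and> raise t (lower t xs) = xs \<and>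
    (\<forall>x \<in> set (lower t xs). valid t x) \<and>
    (xs \<noteq> [] \<longrightarrow> lower t xs \<noteq> [] \<and>
      (hd (lower t xs) = hd xs \<or> (\<exists>y y'. down t (hd xs) y = Some (hd (lower t xs), y') \<and> valid t y)))"
  using assms
proof (induction xs)
  case (Cons x xs)
  have v: "valid t x" using Cons by auto
  have IH: "successively (gap (t + 1)) (lower t xs)" "raise t (lower t xs) = xs"
    "\<forall>x \<in> set (lower t xs). valid t x"
    "xs \<noteq> [] \<Longrightarrow> lower t xs \<noteq> []"
    "xs \<noteq> [] \<Longrightarrow> hd (lower t xs) = hd xs \<or> (\<exists>y y'. down t (hd xs) y = Some (hd (lower t xs), y') \<and> valid t y)"
    using Cons by (auto simp: successively_Cons)
  show ?case
  proof (cases "lower t xs")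
    case Nil
    then have "xs = []" using IH(4) by blast
    then show ?thesis using v by simp
  next
    case (Cons y ys)
    then have ne: "xs \<noteq> []" by auto
    have vy: "valid t y" using IH(3) Cons by simp
    have "gap t x (hd xs)" using Cons.prems ne by (auto simp: successively_Cons)
    moreover have "gap t x y" if "down t (hd xs) z = Some (y, z')" "valid t z" for z z'
      using up_gap_below[OF up_down[OF that] vy] \<open>gap t x (hd xs)\<close> by simp
    ultimately have gxy: "gap t x y"
      using IH(5)[OF ne] Cons by auto
    show ?thesis
    proof (cases "down t x y")
      case None
      then have "gap (t + 1) x y" using gxy gap_of_down_None by blast
      moreover have "up t x y = None" using gap_imp_up_None gxy .
      ultimately show ?thesis
        using None Cons IH v by auto
    next
      case (Some a)
      obtain x' y' where a: "down t x y = Some (x', y')" using Some by fastforce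
      have u: "up t x' y' = Some (x, y)" using up_down[OF a vy] .
      have v': "valid t x'" "valid t y'" using down_valid[OF a v vy] by auto
      have "successively (gap (t + 1)) (y' # ys)"
        using IH(1) Cons up_gap_above[OF u] by (auto simp: successively_Cons)
      then show ?thesis
        using a Cons IH v' u up_gap(2)[OF u v'(1)] vy by auto
    qed
  qed
qed auto

lemma bij_raise: "bij_betw (raise t) (gap_chains (t + 1) t w) (gap_chains t t w)"
proof (rule bij_betw_byWitness[where f' = "lower t"])
  show "raise t ` gap_chains (t + 1) t w \<subseteq> gap_chains t t w"
    using raise_chain raise_valid raise_weight by (auto simp: gap_chains_def)
  show "lower t ` gap_chains t t w \<subseteq> gap_chains (t + 1) t w"
  proof clarsimp
    fix xs assume "xs \<in> gap_chains t t w"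
    then show "lower t xs \<in> gap_chains (t + 1) t w"
      using lower_chain[of t xs] raise_weight[of t "lower t xs"] by (auto simp: gap_chains_def)
  qed
qed (use raise_chain lower_chain in \<open>auto simp: gap_chains_def\<close>)

section \<open>Splitting off the smallest index\<close>

text \<open>
  \<open>attach t\<close> adds the index \<open>t\<close> at the bottom of a list. If the smallest part is primary and its
  index is too close to \<open>t\<close>, the two merge into a secondary part; \<open>detach\<close> is the inverse.
\<close>

fun attach :: "int \<Rightarrow> part list \<Rightarrow> part list" where
  "attach t (Prim i # xs) = (if i \<le> t + 3 then Sec t i # xs else Prim t # Prim i # xs)"
| "attach t xs = Prim t # xs"

fun detach :: "part list \<Rightarrow> part list" where
  "detach (Sec l h # xs) = Prim h # xs"
| "detach xs = tl xs"

lemma slot_above: "t \<le> j \<Longrightarrow> j \<le> slot t j"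
  unfolding slot_def by presburger

lemma slot_first: "t \<le> j \<Longrightarrow> j \<le> t + 2 \<Longrightarrow> slot t j = j"
  unfolding slot_def by presburger

text \<open>Merging \<open>Prim i\<close> with \<open>t\<close> does not change which parts may stand directly above it.\<close>

lemma gap_Sec_first:
  assumes "t < i" "i \<le> t + 3" "valid (t + 1) y"
  shows "gap (t + 1) (Sec t i) y \<longleftrightarrow> gap (t + 1) (Prim i) y"
proof (cases y)
  case (Sec l h)
  have "i < l \<longleftrightarrow> i < slot (t + 1) l"
    using assms Sec slot_above[of "t + 1" l] slot_first[of "t + 1" l] by (cases "l \<le> t + 3") auto
  then show ?thesis using Sec by simp
qed (use assms slot_first[of "t + 1" i] in auto)

lemma gap_Prim_first: "valid (t + 1) (Sec l h) \<Longrightarrow> gap (t + 1) (Prim t) (Sec l h)"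
  using slot_above[of "t + 1" l] by auto

lemma valid_tail:
  "successively (gap (t + 1)) (x # xs) \<Longrightarrow> \<forall>y \<in> set (x # xs). valid t y \<Longrightarrow> \<forall>y \<in> set xs. valid (t + 1) y"
proof (induction xs arbitrary: x)
  case (Cons y ys)
  have g: "gap (t + 1) x y" "valid t x" "valid t y" using Cons.prems by auto
  have "valid (t + 1) y"
  proof (cases y)
    case (Prim i)
    show ?thesis
    proof (cases x)
      case (Sec l h)
      then show ?thesis using g Prim slot_above[of "t + 1" h] by auto
    qed (use g Prim in auto)
  next
    case (Sec l h)
    have "slot (t + 1) t = t - 3" by (simp add: slot_def)
    then show ?thesis using g Sec by (cases x; cases "l = t") auto
  qed
  then show ?case using Cons by auto
qed simp

lemma attach_chain:
  assumes "xs \<in> gap_chains (t + 1) (t + 1) (w - weight t)"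
  shows "attach t xs \<in> gap_chains (t + 1) t w - gap_chains (t + 1) (t + 1) w \<and> detach (attach t xs) = xs"
proof -
  have mono: "valid (t + 1) x \<Longrightarrow> valid t x" for x by (cases x) auto
  have c: "successively (gap (t + 1)) xs" "\<forall>x \<in> set xs. valid (t + 1) x"
    "sum_list (map part_weight xs) + weight t = w"
    using assms by (auto simp: gap_chains_def)
  show ?thesis
  proof (cases xs)
    case Nil
    then show ?thesis using c by (auto simp: gap_chains_def)
  next
    case (Cons x ys)
    show ?thesis
    proof (cases x)
      case (Prim i)
      show ?thesis
      proof (cases "i \<le> t + 3")
        case True
        have "ys \<noteq> [] \<Longrightarrow> gap (t + 1) (Sec t i) (hd ys)"
          using c Cons Prim True gap_Sec_first[of t i "hd ys"] by (cases ys) auto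
        then show ?thesis using c Cons Prim True mono
          by (auto simp: gap_chains_def successively_Cons algebra_simps)
      qed (use c Cons Prim mono in \<open>auto simp: gap_chains_def algebra_simps\<close>)
    next
      case (Sec l h)
      have "gap (t + 1) (Prim t) (Sec l h)"
        using c Cons Sec by (intro gap_Prim_first) auto
      then show ?thesis using c Cons Sec mono
        by (auto simp: gap_chains_def algebra_simps)
    qed
  qed
qed

lemma detach_chain:
  assumes "xs \<in> gap_chains (t + 1) t w - gap_chains (t + 1) (t + 1) w"
  shows "detach xs \<in> gap_chains (t + 1) (t + 1) (w - weight t) \<and> attach t (detach xs) = xs"
proof -
  have c: "successively (gap (t + 1)) xs" "\<forall>x \<in> set xs. valid t x" "sum_list (map part_weight xs) = w"
    "\<exists>x \<in> set xs. \<not> valid (t + 1) x"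
    using assms by (auto simp: gap_chains_def)
  then obtain x ys where xs: "xs = x # ys" by (cases xs) auto
  have ys: "\<forall>y \<in> set ys. valid (t + 1) y" using valid_tail c xs by blast
  then have x: "\<not> valid (t + 1) x" "valid t x" using c xs by auto
  show ?thesis
  proof (cases x)
    case (Prim i)
    then have "i = t" using x by simp
    moreover have "attach t ys = Prim t # ys"
      using c(1) xs Prim \<open>i = t\<close> by (cases ys; cases "hd ys") auto
    ultimately show ?thesis
      using c xs Prim ys by (auto simp: gap_chains_def successively_Cons)
  next
    case (Sec l h)
    then have lh: "l = t" "t < h" "h \<le> t + 3" using x by auto
    have "ys \<noteq> [] \<Longrightarrow> gap (t + 1) (Prim h) (hd ys)"
      using c xs Sec lh ys gap_Sec_first[of t h "hd ys"] by (cases ys) auto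
    then show ?thesis
      using c xs Sec ys lh by (auto simp: gap_chains_def successively_Cons)
  qed
qed

lemma bij_attach:
  "bij_betw (attach t) (gap_chains (t + 1) (t + 1) (w - weight t)) (gap_chains (t + 1) t w - gap_chains (t + 1) (t + 1) w)"
  by (rule bij_betw_byWitness[where f' = detach]) (use attach_chain detach_chain in blast)+

text \<open>The finite sets of indices at least \<open>t\<close> with total weight \<open>w\<close>, as increasing lists.\<close>

definition strict_chains :: "int \<Rightarrow> int \<times> int \<times> int \<times> int \<Rightarrow> int list set" where
  "strict_chains t w = {xs. successively (<) xs \<and> (\<forall>i \<in> set xs. t \<le> i) \<and> sum_list (map weight xs) = w}"

lemma strict_chains_split:
  "strict_chains t w = strict_chains (t + 1) w \<union> (#) t ` strict_chains (t + 1) (w - weight t)"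
proof (intro set_eqI iffI)
  fix xs assume xs: "xs \<in> strict_chains t w"
  show "xs \<in> strict_chains (t + 1) w \<union> (#) t ` strict_chains (t + 1) (w - weight t)"
  proof (cases xs)
    case (Cons i ys)
    have "\<forall>j \<in> set ys. i < j" "t \<le> i"
      using xs Cons by (auto simp: strict_chains_def successively_conv_sorted_wrt)
    then have "\<forall>j \<in> set ys. t + 1 \<le> j" by force
    then show ?thesis
      using xs Cons \<open>t \<le> i\<close> by (cases "i = t") (auto simp: strict_chains_def successively_Cons)
  qed (use xs in \<open>auto simp: strict_chains_def\<close>)
next
  fix xs assume "xs \<in> strict_chains (t + 1) w \<union> (#) t ` strict_chains (t + 1) (w - weight t)"
  moreover have "t < hd ys" if "\<forall>i \<in> set ys. t + 1 \<le> i" "ys \<noteq> []" for ys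
    using that hd_in_set by fastforce
  moreover have "\<forall>i \<in> set ys. t \<le> i" if "\<forall>i \<in> set ys. t + 1 \<le> i" for ys
    using that by force
  ultimately show "xs \<in> strict_chains t w"
    by (auto simp: strict_chains_def successively_Cons) blast+
qed

section \<open>The recursion in the parameter\<close>

text \<open>The size component of a weight.\<close>

abbreviation size_of :: "int \<times> int \<times> int \<times> int \<Rightarrow> int" where
  "size_of w \<equiv> snd (snd (snd w))"

lemma size_of_weight: "0 \<le> t \<Longrightarrow> t \<le> i \<Longrightarrow> t < size_of (weight i)"
  unfolding weight_def by auto presburger+

lemma size_of_part:
  assumes "0 \<le> t" "valid t x"
  shows "t < size_of (part_weight x)"
proof (cases x)
  case (Prim i)
  then show ?thesis using assms size_of_weight[of t i] by simp
next
  case (Sec l h)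
  then show ?thesis using assms size_of_weight[of t l] size_of_weight[of t h] by simp
qed

lemma size_of_sum_list: "size_of (sum_list ws) = sum_list (map size_of ws)"
  by (induction ws) auto

lemma Nil_if_size_small:
  assumes "\<forall>x \<in> set xs. t < size_of (f x)" "0 \<le> t" "size_of (sum_list (map f xs)) \<le> t"
  shows "xs = []"
proof (rule ccontr)
  assume "xs \<noteq> []"
  then obtain x ys where xs: "xs = x # ys" by (cases xs) auto
  have "0 \<le> sum_list (map (\<lambda>x. size_of (f x)) ys)"
    using assms xs by (intro sum_list_nonneg) force
  then show False using assms xs by (auto simp: size_of_sum_list comp_def)
qed

text \<open>
  The induction increases \<open>t\<close> until it is at least the size in \<open>w\<close>, when only the empty list is left.
\<close>

lemma card_chains_eq:
  assumes "0 \<le> t" "size_of w \<le> t + int d"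
  shows "finite (gap_chains t t w) \<and> finite (strict_chains t w) \<and> card (gap_chains t t w) = card (strict_chains t w)"
  using assms
proof (induction d arbitrary: t w)
  case 0
  have "xs = []" if "xs \<in> gap_chains t t w" for xs
    using that 0 size_of_part[of t]
    by (intro Nil_if_size_small[of xs t part_weight]) (auto simp: gap_chains_def)
  moreover have "xs = []" if xs: "xs \<in> strict_chains t w" for xs
  proof (rule Nil_if_size_small)
    show "\<forall>i \<in> set xs. t < size_of (weight i)"
      using xs 0 size_of_weight by (auto simp: strict_chains_def)
  qed (use xs 0 in \<open>auto simp: strict_chains_def\<close>)
  ultimately have "gap_chains t t w \<subseteq> {[]}" "strict_chains t w \<subseteq> {[]}"
    by blast+
  then have "gap_chains t t w = {} \<or> gap_chains t t w = {[]}" "strict_chains t w = {} \<or> strict_chains t w = {[]}"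
    by (simp_all add: subset_singleton_iff)
  moreover have "[] \<in> gap_chains t t w \<longleftrightarrow> [] \<in> strict_chains t w"
    by (simp add: gap_chains_def strict_chains_def)
  ultimately show ?case
    by (elim disjE) simp_all
next
  case (Suc d)
  let ?t = "t + 1"
  have size: "size_of (w - weight t) \<le> ?t + int d"
    using Suc.prems size_of_weight[of t t] by auto
  have IH: "finite (gap_chains ?t ?t v) \<and> finite (strict_chains ?t v) \<and> card (gap_chains ?t ?t v) = card (strict_chains ?t v)"
    if "v \<in> {w, w - weight t}" for v
  proof (rule Suc.IH)
    show "size_of v \<le> ?t + int d"
      using that Suc.prems(2) size by auto
  qed (use Suc.prems in simp)
  have sub: "gap_chains ?t ?t w \<subseteq> gap_chains ?t t w"
  proof -
    have "valid ?t x \<Longrightarrow> valid t x" for x by (cases x) auto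
    then show ?thesis by (auto simp: gap_chains_def)
  qed
  \<comment> \<open>the lists in which the index \<open>t\<close> occurs\<close>
  define E where "E = gap_chains ?t t w - gap_chains ?t ?t w"
  have E: "finite E" "card E = card (gap_chains ?t ?t (w - weight t))"
    using bij_attach[of t w] IH bij_betw_finite bij_betw_same_card unfolding E_def by (blast, metis)
  have "gap_chains ?t t w = gap_chains ?t ?t w \<union> E" "gap_chains ?t ?t w \<inter> E = {}"
    using sub E_def by auto
  then have 1: "finite (gap_chains ?t t w)"
    "card (gap_chains ?t t w) = card (gap_chains ?t ?t w) + card (gap_chains ?t ?t (w - weight t))"
    using E IH card_Un_disjoint[of "gap_chains ?t ?t w" E] by auto
  have "t \<notin> set xs" if "xs \<in> strict_chains ?t w" for xs
    using that unfolding strict_chains_def by force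
  then have disj: "strict_chains ?t w \<inter> (#) t ` strict_chains ?t (w - weight t) = {}"
    by fastforce
  have "finite ((#) t ` strict_chains ?t (w - weight t))"
    "card ((#) t ` strict_chains ?t (w - weight t)) = card (strict_chains ?t (w - weight t))"
    using IH by (simp_all add: card_image)
  then have 2: "finite (strict_chains t w)"
    "card (strict_chains t w) = card (strict_chains ?t w) + card (strict_chains ?t (w - weight t))"
    using IH[of w] card_Un_disjoint[OF _ _ disj] unfolding strict_chains_split[of t w] by simp_all
  have 3: "finite (gap_chains t t w)" "card (gap_chains t t w) = card (gap_chains ?t t w)"
    using bij_betw_finite[OF bij_raise[of t w]] bij_betw_same_card[OF bij_raise[of t w]] 1(1) by simp_all
  show ?case
    using 1(2) 2 3 IH by simp
qed

section \<open>Translating the difference conditions\<close>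

text \<open>The primary or secondary part whose size is \<open>20 * k + r\<close>, for \<open>r\<close> in the set \<open>residues\<close> below.\<close>

definition part_at :: "nat \<Rightarrow> int \<Rightarrow> part" where
  "part_at r k =
    (if r = 0 then Sec (3 * k - 2) (3 * k)
     else if r = 2 then Sec (3 * k - 2) (3 * k + 1)
     else if r = 3 then Sec (3 * k - 1) (3 * k)
     else if r = 4 then Prim (6 * k)
     else if r = 5 then Sec (3 * k - 1) (3 * k + 1)
     else if r = 6 then Prim (6 * k + 1)
     else if r = 8 then Sec (3 * k - 1) (3 * k + 2)
     else if r = 9 then Prim (6 * k + 2)
     else if r = 10 then Sec (3 * k) (3 * k + 1)
     else if r = 13 then Sec (3 * k) (3 * k + 2)
     else if r = 14 then Prim (6 * k + 3)
     else if r = 15 then Sec (3 * k + 1) (3 * k + 2)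
     else if r = 16 then Prim (6 * k + 4)
     else if r = 18 then Sec (3 * k) (3 * k + 3)
     else Prim (6 * k + 5))"

text \<open>The part of size \<open>p\<close>; each admissible size, defined below, belongs to exactly one part.\<close>

definition decode :: "nat \<Rightarrow> part" where
  "decode p = part_at (p mod 20) (int (p div 20))"

text \<open>The residues modulo 20 that occur among the parts counted by \<open>B\<close>.\<close>

definition residues :: "nat set" where
  "residues = {0, 2, 3, 4, 5, 6, 8, 9, 10, 13, 14, 15, 16, 18, 19}"

text \<open>
  The numbers allowed as parts in the partitions counted by \<open>B\<close>. The excluded numbers 2, 3, 5, 8 (and 0) are those for which \<open>decode\<close> gives a
  secondary part with a negative index.
\<close>

definition admissible :: "nat \<Rightarrow> bool" where
  "admissible p \<longleftrightarrow> 0 < p \<and> p \<notin> {2, 3, 5, 8} \<and> p mod 20 \<notin> {1, 7, 11, 12, 17}"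

lemma residues_less: "r \<in> residues \<Longrightarrow> r < 20"
  by (auto simp: residues_def)

lemma decode_add: "r \<in> residues \<Longrightarrow> decode (20 * m + r) = part_at r (int m)"
  using residues_less[of r] by (simp add: decode_def)

lemma admissibleE:
  assumes "admissible p"
  obtains m r where "p = 20 * m + r" "r \<in> residues" "m = 0 \<longrightarrow> r \<notin> {0, 2, 3, 5, 8}"
proof (rule that[of "p div 20" "p mod 20"])
  have "r \<in> residues" if "r < 20" "r \<notin> {1, 7, 11, 12, 17}" for r
    using that unfolding residues_def by simp presburger
  then show "p mod 20 \<in> residues"
    using assms unfolding admissible_def by simp
  show "p div 20 = 0 \<longrightarrow> p mod 20 \<notin> {0, 2, 3, 5, 8}"
    using assms by (auto simp: admissible_def)
qed simp

lemma admissibleI: "r \<in> residues \<Longrightarrow> m = 0 \<longrightarrow> r \<notin> {0, 2, 3, 5, 8} \<Longrightarrow> admissible (20 * m + r)"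
  unfolding residues_def admissible_def by (cases m) auto

lemma slot_0:
  "slot 0 (3 * k) = 6 * k" "slot 0 (3 * k + 1) = 6 * k + 1" "slot 0 (3 * k + 2) = 6 * k + 2"
  "slot 0 (3 * k + 3) = 6 * k + 6" "slot 0 (3 * k - 1) = 6 * k - 4" "slot 0 (3 * k - 2) = 6 * k - 5"
  using slot_block[of 0 k "3 * k"] slot_block[of 0 k "3 * k + 1"] slot_block[of 0 k "3 * k + 2"]
    slot_block[of 0 "k + 1" "3 * k + 3"] slot_block[of 0 "k - 1" "3 * k - 1"] slot_block[of 0 "k - 1" "3 * k - 2"]
  by simp_all

text \<open>The difference condition for a part \<open>p\<close> and the next smaller part \<open>q\<close>.\<close>

definition differ :: "nat \<Rightarrow> nat \<Rightarrow> bool" where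
  "differ p q \<longleftrightarrow> 9 \<le> p - q \<and> (p - q \<le> 20 \<longrightarrow> p mod 20 \<in> allowed_residues (p - q))"

lemma differ_iff:
  "differ p q \<longleftrightarrow> q + 20 < p \<or>
    (\<exists>d \<in> {9, 11, 12, 13, 14, 15, 16, 17, 18, 19, 20}. p = q + d \<and> p mod 20 \<in> allowed_residues d)"
proof (cases "q + 20 < p")
  case False
  have d: "d \<in> {9, 11, 12, 13, 14, 15, 16, 17, 18, 19, 20}" if "x \<in> allowed_residues d" for x d
    using that by (rule contrapos_pp) (simp add: allowed_residues_def)
  show ?thesis
  proof
    assume "differ p q"
    then have "p = q + (p - q)" "p mod 20 \<in> allowed_residues (p - q)"
      using False by (auto simp: differ_def)
    then show "q + 20 < p \<or>
      (\<exists>d \<in> {9, 11, 12, 13, 14, 15, 16, 17, 18, 19, 20}. p = q + d \<and> p mod 20 \<in> allowed_residues d)"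
      using d by blast
  next
    assume "q + 20 < p \<or>
      (\<exists>d \<in> {9, 11, 12, 13, 14, 15, 16, 17, 18, 19, 20}. p = q + d \<and> p mod 20 \<in> allowed_residues d)"
    then obtain d where "p = q + d" "d \<in> {9, 11, 12, 13, 14, 15, 16, 17, 18, 19, 20}"
      "p mod 20 \<in> allowed_residues d"
      using False by blast
    moreover from this(2) have "9 \<le> d" by auto
    ultimately show "differ p q"
      unfolding differ_def by (metis add_diff_cancel_left')
  qed
next
  case True
  then have "9 \<le> p - q" "\<not> p - q \<le> 20"
    by linarith+
  then show ?thesis
    using True by (simp only: differ_def simp_thms)
qed

text \<open>
  Both sides depend only on \<open>r\<close>, \<open>s\<close> and \<open>m - k\<close>; they fail for \<open>m < k\<close> and hold for \<open>m > k + 1\<close>, and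
  the two remaining values of \<open>m - k\<close> are checked residue by residue.
\<close>

lemma gap_part_at:
  assumes "r \<in> residues" "s \<in> residues"
  shows "gap 0 (part_at s (int k)) (part_at r (int m)) \<longleftrightarrow> differ (20 * m + r) (20 * k + s)"
proof -
  have below: "m < k \<Longrightarrow> \<not> gap 0 (part_at s k) (part_at r m)" for k m :: int
    using assms unfolding residues_def
    by (elim insertE emptyE; simp add: part_at_def slot_0)
  have same: "gap 0 (part_at s (int k)) (part_at r (int k)) \<longleftrightarrow> differ (20 * k + r) (20 * k + s)"
    using assms unfolding residues_def
    by (elim insertE emptyE; simp add: part_at_def slot_0 differ_iff allowed_residues_def)
  have "k < m \<Longrightarrow> m < k + 2 \<Longrightarrow> gap 0 (part_at s k) (part_at r m) \<longleftrightarrow> differ (20 * (k' + 1) + r) (20 * k' + s)"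
    for k m :: int and k' :: nat
    using assms unfolding residues_def
    by (elim insertE emptyE; simp add: part_at_def slot_0 differ_iff allowed_residues_def)
  from this[of "int k" "int k + 1" k]
  have succ: "gap 0 (part_at s (int k)) (part_at r (int (k + 1))) \<longleftrightarrow> differ (20 * (k + 1) + r) (20 * k + s)"
    by (simp add: add.commute)
  have above: "k + 1 < m \<Longrightarrow> gap 0 (part_at s k) (part_at r m)" for k m :: int
    using assms unfolding residues_def
    by (elim insertE emptyE; simp add: part_at_def slot_0)
  note less = residues_less[OF assms(1)] residues_less[OF assms(2)]
  consider "m < k" | "m = k" | "m = k + 1" | "k + 1 < m" by linarith
  then show ?thesis
  proof cases
    case 1
    then have "20 * m + r \<le> 20 * k + s" using less by linarith
    then show ?thesis using below[of "int m" "int k"] 1 by (simp add: differ_def)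
  next
    case 4
    then have "20 * k + s + 20 < 20 * m + r" using less by linarith
    then show ?thesis using above[of "int k" "int m"] 4 by (simp add: differ_iff)
  qed (use same succ in simp_all)
qed

lemma gap_decode:
  assumes "admissible p" "admissible q"
  shows "gap 0 (decode q) (decode p) \<longleftrightarrow> differ p q"
  using assms by (elim admissibleE) (simp add: decode_add gap_part_at)

lemma valid_decode:
  assumes "admissible p"
  shows "valid 0 (decode p)"
proof -
  obtain m r where p: "p = 20 * m + r" "r \<in> residues" "m = 0 \<longrightarrow> r \<notin> {0, 2, 3, 5, 8}"
    using assms by (elim admissibleE)
  have "valid 0 (part_at r (int m))"
    using p(2,3) unfolding residues_def by (elim insertE emptyE; simp add: part_at_def)
  then show ?thesis
    using p decode_add by simp
qed

lemma weight_block: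
  "weight (3 * k) = (1, 0, 0, 10 * k + 4)" "weight (3 * k + 1) = (0, 1, 0, 10 * k + 6)"
  "weight (3 * k + 2) = (0, 0, 1, 10 * k + 9)"
  by (simp_all add: weight_def)

lemma weight_shifted:
  "weight (3 * k + 3) = (1, 0, 0, 10 * k + 14)" "weight (3 * k - 2) = (0, 1, 0, 10 * k - 4)"
  "weight (3 * k - 1) = (0, 0, 1, 10 * k - 1)"
  "weight (6 * k) = (1, 0, 0, 20 * k + 4)" "weight (6 * k + 1) = (0, 1, 0, 20 * k + 6)"
  "weight (6 * k + 2) = (0, 0, 1, 20 * k + 9)" "weight (6 * k + 3) = (1, 0, 0, 20 * k + 14)"
  "weight (6 * k + 4) = (0, 1, 0, 20 * k + 16)" "weight (6 * k + 5) = (0, 0, 1, 20 * k + 19)"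
  using weight_block(1)[of "k + 1"] weight_block(2)[of "k - 1"] weight_block(3)[of "k - 1"]
    weight_block(1)[of "2 * k"] weight_block(2)[of "2 * k"] weight_block(3)[of "2 * k"]
    weight_block(1)[of "2 * k + 1"] weight_block(2)[of "2 * k + 1"] weight_block(3)[of "2 * k + 1"]
  by (simp_all add: add.commute)

text \<open>The contribution of a single part to \<open>num_parts\<close>.\<close>

definition of_res :: "nat \<Rightarrow> nat set \<Rightarrow> nat \<Rightarrow> int" where
  "of_res m R p = (if p mod m \<in> R then 1 else 0)"

text \<open>The contributions of a single part to \<open>u\<close>, \<open>v\<close>, \<open>w\<close> and \<open>n\<close> are its weight.\<close>

lemma weight_decode:
  assumes "admissible p"
  shows "part_weight (decode p) =
    (of_res 10 {0, 3, 4} p + 2 * of_res 20 {18} p, of_res 10 {0, 5, 6} p + 2 * of_res 20 {2} p,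
     of_res 10 {3, 5, 9} p + 2 * of_res 20 {8} p, int p)"
proof -
  obtain m r where p: "p = 20 * m + r" "r \<in> residues" using assms by (elim admissibleE)
  have *: "(20 * m + r) mod 10 = r mod 10" "(20 * m + r) mod 20 = r"
    using residues_less[OF p(2)] mod_mult_self4[of 10 "2 * m" r] by simp_all
  have "part_weight (part_at r (int m)) =
    (of_res 10 {0, 3, 4} p + 2 * of_res 20 {18} p, of_res 10 {0, 5, 6} p + 2 * of_res 20 {2} p,
     of_res 10 {3, 5, 9} p + 2 * of_res 20 {8} p, int p)"
    unfolding p(1) of_res_def * using p(2) unfolding residues_def
    by (elim insertE emptyE; simp add: part_at_def weight_block weight_shifted)
  then show ?thesis
    using p decode_add by simp
qed

lemma decode_surj:
  assumes "valid 0 x"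
  obtains p where "admissible p" "decode p = x"
proof -
  have "\<exists>r \<in> residues. \<exists>m::nat. (m = 0 \<longrightarrow> r \<notin> {0, 2, 3, 5, 8}) \<and> part_at r (int m) = x"
  proof (cases x)
    case (Prim i)
    define k where "k = nat (i div 6)"
    define s where "s = i mod 6"
    have "0 \<le> s" "s < 6" by (simp_all add: s_def)
    then have "s \<in> {0, 1, 2, 3, 4, 5}" by auto
    moreover have "i = 6 * int k + s"
      using assms Prim by (simp add: k_def s_def pos_imp_zdiv_nonneg_iff)
    ultimately have "\<exists>r \<in> {4, 6, 9, 14, 16, 19}. part_at r (int k) = x"
      using Prim by (elim insertE emptyE) (simp_all add: part_at_def)
    moreover have "r \<in> residues \<and> r \<notin> {0, 2, 3, 5, 8}" if "r \<in> {4, 6, 9, 14, 16, 19}" for r :: nat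
      using that by (auto simp: residues_def)
    ultimately show ?thesis by blast
  next
    case (Sec l h)
    define k where "k = nat (l div 3)"
    define s where "s = l mod 3"
    have "0 \<le> s" "s < 3" by (simp_all add: s_def)
    then have s: "s \<in> {0, 1, 2}" by auto
    have l: "l = 3 * int k + s"
      using assms Sec by (simp add: k_def s_def pos_imp_zdiv_nonneg_iff)
    define d where "d = h - l"
    have d: "d \<in> {1, 2, 3}" "h = l + d"
      using assms Sec by (auto simp: d_def)
    have "(\<exists>r \<in> {10, 13, 15, 18}. part_at r (int k) = x) \<or>
      (\<exists>r \<in> {0, 2, 3, 5, 8}. part_at r (int (Suc k)) = x)"
      using s d(1) unfolding Sec d(2) l by (elim insertE emptyE) (simp_all add: part_at_def)
    moreover have "r \<in> residues \<and> r \<notin> {0, 2, 3, 5, 8}" if "r \<in> {10, 13, 15, 18}" for r :: nat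
      using that by (auto simp: residues_def)
    moreover have "r \<in> residues" if "r \<in> {0, 2, 3, 5, 8}" for r :: nat
      using that by (auto simp: residues_def)
    ultimately show ?thesis by blast
  qed
  then show thesis
    using that admissibleI decode_add by metis
qed

section \<open>Counting the two families of partitions\<close>

text \<open>
  Transport of a count along a bijection \<open>f\<close> between the elements satisfying \<open>P\<close> and those satisfying \<open>Q\<close>.
  The lists are reversed because partitions start with the largest part.
\<close>

lemma card_map_rev:
  fixes f :: "'a \<Rightarrow> 'b" and g :: "'b \<Rightarrow> 'c::comm_monoid_add"
  assumes inj: "inj_on f {p. P p}"
    and Q: "\<And>x. Q x \<longleftrightarrow> (\<exists>p. P p \<and> f p = x)"
    and R: "\<And>p q. P p \<Longrightarrow> P q \<Longrightarrow> R (f q) (f p) \<longleftrightarrow> S p q"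
  shows "card {ps. (\<forall>p \<in> set ps. P p) \<and> successively S ps \<and> sum_list (map (g \<circ> f) ps) = w} =
    card {xs. successively R xs \<and> (\<forall>x \<in> set xs. Q x) \<and> sum_list (map g xs) = w}"
    (is "card ?X = card ?Y")
proof (rule bij_betw_same_card)
  let ?F = "\<lambda>ps. map f (rev ps)"
  have mem: "?F ps \<in> ?Y \<longleftrightarrow> ps \<in> ?X" if "\<forall>p \<in> set ps. P p" for ps
  proof -
    have "successively R (?F ps) \<longleftrightarrow> successively S ps"
      unfolding successively_map successively_rev using that R by (intro successively_cong) auto
    moreover have "sum_list (map g (?F ps)) = sum_list (map (g \<circ> f) ps)"
      by (simp add: rev_map[symmetric] sum_list.rev)
    ultimately show ?thesis using that Q by auto
  qed
  show "bij_betw ?F ?X ?Y"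
  proof (rule bij_betw_imageI)
    show "inj_on ?F ?X"
    proof (rule inj_onI)
      fix xs ys assume *: "xs \<in> ?X" "ys \<in> ?X" "?F xs = ?F ys"
      have "inj_on f (set (rev xs) \<union> set (rev ys))"
        using *(1,2) by (intro inj_on_subset[OF inj]) auto
      then have "rev xs = rev ys"
        using *(3) map_inj_on by blast
      then show "xs = ys" by simp
    qed
    show "?F ` ?X = ?Y"
    proof (intro equalityI subsetI)
      fix xs assume xs: "xs \<in> ?Y"
      define h where "h x = (SOME p. P p \<and> f p = x)" for x
      have h: "P (h x) \<and> f (h x) = x" if "x \<in> set xs" for x
      proof -
        have "\<exists>p. P p \<and> f p = x"
          using xs that by (simp flip: Q)
        then show ?thesis
          unfolding h_def by (rule someI_ex)
      qed
      then have F: "?F (rev (map h xs)) = xs"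
        by (simp add: map_idI)
      have "\<forall>p \<in> set (rev (map h xs)). P p"
        using h by simp
      from mem[OF this] have X: "rev (map h xs) \<in> ?X"
        unfolding F using xs by simp
      show "xs \<in> ?F ` ?X"
        using imageI[OF X, of ?F] unfolding F .
    next
      fix xs assume "xs \<in> ?F ` ?X"
      then obtain ps where ps: "xs = ?F ps" "ps \<in> ?X" by (rule imageE)
      then have "\<forall>p \<in> set ps. P p" by simp
      from mem[OF this] show "xs \<in> ?Y"
        unfolding ps(1) using ps(2) by (rule iffD2)
    qed
  qed
qed

lemma num_parts_simps:
  "num_parts m R [] = 0"
  "int (num_parts m R (p # ps)) = of_res m R p + int (num_parts m R ps)"
  by (simp_all add: num_parts_def of_res_def)

lemma B_eq_card_gap_chains: "B u v w n = card (gap_chains 0 0 (int u, int v, int w, int n))"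
proof -
  have weight: "sum_list (map (part_weight \<circ> decode) ps) =
     (int (num_parts 10 {0, 3, 4} ps) + 2 * int (num_parts 20 {18} ps),
      int (num_parts 10 {0, 5, 6} ps) + 2 * int (num_parts 20 {2} ps),
      int (num_parts 10 {3, 5, 9} ps) + 2 * int (num_parts 20 {8} ps), int (sum_list ps))"
    if "\<forall>p \<in> set ps. admissible p" for ps
    using that by (induction ps) (simp_all add: num_parts_simps weight_decode zero_prod_def)
  have diff: "difference_conditions ps \<longleftrightarrow> successively differ ps" for ps
    by (simp add: difference_conditions_def successively_conv_nth differ_def Let_def)
  have sorted: "sorted_wrt (\<ge>) ps" if "successively differ ps" for ps
  proof -
    have "successively (\<ge>) ps"
      using that by (rule successively_mono) (auto simp: differ_def)
    then show ?thesis
      by (subst (asm) successively_conv_sorted_wrt) (auto simp: transp_def)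
  qed
  have eq: "is_partition n ps \<and> (\<forall>p \<in> set ps. p \<notin> {2, 3, 5, 8} \<and> p mod 20 \<notin> {1, 7, 11, 12, 17}) \<and>
     u = num_parts 10 {0, 3, 4} ps + 2 * num_parts 20 {18} ps \<and>
     v = num_parts 10 {0, 5, 6} ps + 2 * num_parts 20 {2} ps \<and>
     w = num_parts 10 {3, 5, 9} ps + 2 * num_parts 20 {8} ps \<and>
     difference_conditions ps \<longleftrightarrow>
    (\<forall>p \<in> set ps. admissible p) \<and> successively differ ps \<and>
     sum_list (map (part_weight \<circ> decode) ps) = (int u, int v, int w, int n)" for ps
  proof (cases "\<forall>p \<in> set ps. admissible p")
    case True
    then have "is_partition n ps \<and> difference_conditions ps \<longleftrightarrow> successively differ ps \<and> sum_list ps = n"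
      using sorted diff by (auto simp: is_partition_def admissible_def)
    moreover have "\<forall>p \<in> set ps. p \<notin> {2, 3, 5, 8} \<and> p mod 20 \<notin> {1, 7, 11, 12, 17}"
      using True by (auto simp: admissible_def)
    moreover have "sum_list (map (part_weight \<circ> decode) ps) = (int u, int v, int w, int n) \<longleftrightarrow>
      u = num_parts 10 {0, 3, 4} ps + 2 * num_parts 20 {18} ps \<and>
      v = num_parts 10 {0, 5, 6} ps + 2 * num_parts 20 {2} ps \<and>
      w = num_parts 10 {3, 5, 9} ps + 2 * num_parts 20 {8} ps \<and> sum_list ps = n"
      unfolding weight[OF True] prod.inject by linarith
    ultimately show ?thesis
      using True by blast
  next
    case False
    then show ?thesis by (auto simp: admissible_def is_partition_def)
  qed
  have "size_of (part_weight (decode p)) = int p" if "admissible p" for p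
    by (simp add: weight_decode[OF that])
  then have inj: "inj_on decode {p. admissible p}"
    by (intro inj_on_inverseI[where g = "\<lambda>x. nat (size_of (part_weight x))"]) simp
  have "valid 0 x \<longleftrightarrow> (\<exists>p. admissible p \<and> decode p = x)" for x
    using valid_decode decode_surj by metis
  then have "card {ps. (\<forall>p \<in> set ps. admissible p) \<and> successively differ ps \<and>
      sum_list (map (part_weight \<circ> decode) ps) = (int u, int v, int w, int n)} =
    card (gap_chains 0 0 (int u, int v, int w, int n))"
    unfolding gap_chains_def using gap_decode by (intro card_map_rev[OF inj])
  then show ?thesis
    unfolding B_def eq .
qed

text \<open>The index of a number congruent to 4, 6 or 9 modulo 10 among all such numbers.\<close>

definition index :: "nat \<Rightarrow> int" where
  "index p = 3 * int (p div 10) + (if p mod 10 = 4 then 0 else if p mod 10 = 6 then 1 else 2)"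

lemma weight_index:
  assumes "p mod 10 \<in> {4, 6, 9}"
  shows "weight (index p) = (of_res 10 {4} p, of_res 10 {6} p, of_res 10 {9} p, int p)"
proof -
  have "int p = 10 * int (p div 10) + int (p mod 10)"
    by (metis mult_div_mod_eq of_nat_add of_nat_mult of_nat_numeral)
  then show ?thesis
    using assms by (elim insertE emptyE) (simp_all add: index_def of_res_def weight_block)
qed

lemma index_nonneg: "0 \<le> index p"
  by (simp add: index_def)

lemma index_mono:
  assumes "p mod 10 \<in> {4, 6, 9}" "q mod 10 \<in> {4, 6, 9}" "p < q"
  shows "index p < index q"
proof (cases "p div 10 = q div 10")
  case True
  then have "p mod 10 < q mod 10"
    using assms(3) mult_div_mod_eq[of 10 p] mult_div_mod_eq[of 10 q] by linarith
  then show ?thesis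
    using assms(1,2) True by (auto simp: index_def)
next
  case False
  then have "p div 10 + 1 \<le> q div 10"
    using div_le_mono[of p q 10] assms(3) by simp
  then have "3 * int (p div 10) + 3 \<le> 3 * int (q div 10)"
    by linarith
  then show ?thesis
    by (simp add: index_def)
qed

lemma index_surj:
  assumes "0 \<le> i"
  obtains p where "p mod 10 \<in> {4, 6, 9}" "index p = i"
proof -
  define k where "k = nat (i div 3)"
  define s where "s = i mod 3"
  have "0 \<le> s" "s < 3" by (simp_all add: s_def)
  then have s: "s \<in> {0, 1, 2}" by auto
  have i: "i = 3 * int k + s"
    using assms by (simp add: k_def s_def pos_imp_zdiv_nonneg_iff)
  have "\<exists>r \<in> {4, 6, 9}. (10 * k + r) mod 10 \<in> {4, 6, 9} \<and> index (10 * k + r) = i"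
    using s unfolding i by (elim insertE emptyE) (simp_all add: index_def)
  then show thesis using that by blast
qed

lemma A_eq_card_strict_chains: "A u v w n = card (strict_chains 0 (int u, int v, int w, int n))"
proof -
  let ?P = "\<lambda>p::nat. p mod 10 \<in> {4, 6, 9}"
  have weight: "sum_list (map (weight \<circ> index) ps) =
     (int (num_parts 10 {4} ps), int (num_parts 10 {6} ps), int (num_parts 10 {9} ps), int (sum_list ps))"
    if "\<forall>p \<in> set ps. ?P p" for ps
    using that by (induction ps) (simp_all add: num_parts_simps weight_index zero_prod_def)
  have sorted: "successively (>) ps \<longleftrightarrow> sorted_wrt (\<ge>) ps \<and> distinct ps" for ps :: "nat list"
  proof -
    have "successively (>) ps \<longleftrightarrow> sorted_wrt (>) ps"
      by (rule successively_conv_sorted_wrt) (auto simp: transp_def)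
    also have "\<dots> \<longleftrightarrow> sorted_wrt (\<ge>) ps \<and> distinct ps"
      by (induction ps) (auto simp: order_less_le)
    finally show ?thesis .
  qed
  have eq: "is_partition n ps \<and> distinct ps \<and> (\<forall>p \<in> set ps. ?P p) \<and>
     num_parts 10 {4} ps = u \<and> num_parts 10 {6} ps = v \<and> num_parts 10 {9} ps = w \<longleftrightarrow>
    (\<forall>p \<in> set ps. ?P p) \<and> successively (>) ps \<and>
     sum_list (map (weight \<circ> index) ps) = (int u, int v, int w, int n)" for ps
  proof (cases "\<forall>p \<in> set ps. ?P p")
    case True
    moreover have "\<forall>p \<in> set ps. 0 < p" using True by fastforce
    ultimately show ?thesis
      unfolding weight[OF True] sorted is_partition_def prod.inject of_nat_eq_iff by blast
  qed blast
  have "size_of (weight (index p)) = int p" if "?P p" for p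
    by (simp add: weight_index[OF that])
  then have inj: "inj_on index {p. ?P p}"
    by (intro inj_on_inverseI[where g = "\<lambda>i. nat (size_of (weight i))"]) simp
  have "0 \<le> i \<longleftrightarrow> (\<exists>p. ?P p \<and> index p = i)" for i
    using index_surj[of i] index_nonneg by metis
  moreover have "index q < index p \<longleftrightarrow> p > q" if "?P p" "?P q" for p q
    using index_mono[of q p] index_mono[of p q] that by (cases p q rule: linorder_cases) auto
  ultimately have "card {ps. (\<forall>p \<in> set ps. ?P p) \<and> successively (>) ps \<and>
      sum_list (map (weight \<circ> index) ps) = (int u, int v, int w, int n)} =
    card (strict_chains 0 (int u, int v, int w, int n))"
    unfolding strict_chains_def by (intro card_map_rev[OF inj])
  then show ?thesis
    unfolding A_def eq .
qed

theorem corollary1p5: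
  fixes u v w n :: nat
  shows "A u v w n = B u v w n"
  using card_chains_eq[of 0 "(int u, int v, int w, int n)" n]
  by (simp add: A_eq_card_strict_chains B_eq_card_gap_chains)

end
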